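(* Let $m \ge n \ge 0$ be integers, let $a_{m,n}\in\mathbb{C}$, and let $\varphi(z)=a_{m,n}z^{m}\bar{z}^{n}$ for $z\in\mathbb{D}$. Then the Toeplitz operator $T_{\varphi}$ acting on the Bergman space $A^{2}(\mathbb{D})$ is hyponormal.
   Context: $\mathbb{D}$ is the open unit disc in $\mathbb{C}$. The Bergman space is $A^{2}(\mathbb{D})=\{f \text{ holomorphic on }\mathbb{D}:\int_{\mathbb{D}}|f(z)|^{2}\,dA(z)<\infty\}$, where $dA$ is area measure, regarded as a closed subspace of $L^{2}(\mathbb{D})$. For $\varphi\in L^{\infty}(\mathbb{D})$, the Toeplitz operator is $T_{\varphi}f=P(\varphi f)$ for $f\in A^{2}(\mathbb{D})$, where $P$ is the orthogonal projection from $L^{2}(\mathbb{D})$ onto $A^{2}(\mathbb{D})$. A bounded operator $T$ on a complex Hilbert space $H$ is hyponormal if $[T^{*},T]:=T^{*}T-TT^{*}\ge 0$, i.e. $\langle [T^{*},T]u,u\rangle\ge 0$ for all $u\in H$. *)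

theory Defs
  imports "HOL-Analysis.Analysis"
begin

abbreviation unit_disc :: "complex set" (\<open>\<bbbD>\<close>)
  where "\<bbbD> \<equiv> ball 0 1"

text \<open>
  Elements of \<open>L\<^sup>2(\<bbbD>)\<close> are given by representatives: the functions in \<open>L2_disc\<close>, whose values
  off the disc are irrelevant.  \<open>L2_inner\<close> and \<open>bergman_proj\<close> depend only on
  the almost-everywhere classes of their arguments.
\<close>

definition L2_disc :: "(complex \<Rightarrow> complex) set" where
  "L2_disc = {f. f \<in> borel_measurable (lebesgue_on \<bbbD>) \<and>
                 integrable (lebesgue_on \<bbbD>) (\<lambda>z. (cmod (f z))\<^sup>2)}"

definition L2_inner :: "(complex \<Rightarrow> complex) \<Rightarrow> (complex \<Rightarrow> complex) \<Rightarrow> complex" where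
  "L2_inner f g = (LINT z|lebesgue_on \<bbbD>. f z * cnj (g z))"

text \<open>
  A holomorphic function on the disc is represented by its extension by zero.  So two members of
  \<open>bergman_space\<close> are equal as HOL functions iff they agree on the disc, and \<open>L2_inner\<close> is a
  genuine (definite) inner product on \<open>bergman_space\<close>.
\<close>

definition bergman_space :: "(complex \<Rightarrow> complex) set" where
  "bergman_space = {f \<in> L2_disc. f holomorphic_on \<bbbD> \<and> (\<forall>z. z \<notin> \<bbbD> \<longrightarrow> f z = 0)}"

definition bergman_proj :: "(complex \<Rightarrow> complex) \<Rightarrow> complex \<Rightarrow> complex" where
  "bergman_proj g = (THE f. f \<in> bergman_space \<and>
                            (\<forall>h\<in>bergman_space. L2_inner (\<lambda>z. g z - f z) h = 0))"

text \<open>The symbol \<open>\<phi>\<close> is meant to be measurable and essentially bounded on the disc.\<close>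

definition toeplitz :: "(complex \<Rightarrow> complex) \<Rightarrow> (complex \<Rightarrow> complex) \<Rightarrow> complex \<Rightarrow> complex" where
  "toeplitz \<phi> f = bergman_proj (\<lambda>z. \<phi> z * f z)"

text \<open>
  Operators on a complex Hilbert space \<open>H\<close> of functions under pointwise operations, with inner
  product \<open>ip\<close> (linear in the first argument).  Operators are only considered on \<open>H\<close>; their values
  on other functions are irrelevant.
\<close>

definition bounded_operator_on ::
  "('a \<Rightarrow> complex) set \<Rightarrow> (('a \<Rightarrow> complex) \<Rightarrow> ('a \<Rightarrow> complex) \<Rightarrow> complex) \<Rightarrow>
   (('a \<Rightarrow> complex) \<Rightarrow> 'a \<Rightarrow> complex) \<Rightarrow> bool" where
  "bounded_operator_on H ip T \<longleftrightarrow>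
     (\<forall>u\<in>H. T u \<in> H) \<and>
     (\<forall>u\<in>H. \<forall>v\<in>H. T (\<lambda>x. u x + v x) = (\<lambda>x. T u x + T v x)) \<and>
     (\<forall>c. \<forall>u\<in>H. T (\<lambda>x. c * u x) = (\<lambda>x. c * T u x)) \<and>
     (\<exists>C. \<forall>u\<in>H. sqrt (Re (ip (T u) (T u))) \<le> C * sqrt (Re (ip u u)))"

definition adjoint_on ::
  "('a \<Rightarrow> complex) set \<Rightarrow> (('a \<Rightarrow> complex) \<Rightarrow> ('a \<Rightarrow> complex) \<Rightarrow> complex) \<Rightarrow>
   (('a \<Rightarrow> complex) \<Rightarrow> 'a \<Rightarrow> complex) \<Rightarrow> ('a \<Rightarrow> complex) \<Rightarrow> 'a \<Rightarrow> complex" where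
  "adjoint_on H ip T v = (THE w. w \<in> H \<and> (\<forall>u\<in>H. ip (T u) v = ip u w))"

definition hyponormal_on ::
  "('a \<Rightarrow> complex) set \<Rightarrow> (('a \<Rightarrow> complex) \<Rightarrow> ('a \<Rightarrow> complex) \<Rightarrow> complex) \<Rightarrow>
   (('a \<Rightarrow> complex) \<Rightarrow> 'a \<Rightarrow> complex) \<Rightarrow> bool" where
  "hyponormal_on H ip T \<longleftrightarrow>
     bounded_operator_on H ip T \<and>
     (\<forall>u\<in>H. ip (\<lambda>x. adjoint_on H ip T (T u) x - T (adjoint_on H ip T u) x) u \<in> \<real>\<^sub>\<ge>\<^sub>0)"

end

theory Submission
  imports Defs "HOL-Complex_Analysis.Cauchy_Integral_Formula"
begin

text \<open>
A holomorphic \<open>f\<close> on the disc is the sum of its Taylor series \<open>\<Sum>k. c k * z ^ k\<close>.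
Since the monomials are orthogonal with \<open>\<parallel>z ^ k\<parallel>\<^sup>2 = \<pi> / (k + 1)\<close>, sending \<open>f\<close> to \<open>c\<close> identifies
the Bergman space with the sequences for which \<open>\<Sum>k. \<bar>c k\<bar>\<^sup>2 / (k + 1)\<close> converges, and \<open>\<pi>\<close> times
that weighted inner product is the inner product of \<open>L\<^sup>2\<close> (\<open>bergman_space_cases\<close>,
\<open>disc_series_in_bergman\<close>, \<open>L2_inner_disc_series\<close>).

For \<open>\<phi> z = a * z ^ m * cnj z ^ n\<close> and \<open>u\<close>, \<open>v\<close> in the Bergman space, moving the
factor \<open>cnj z ^ n\<close> to the other side gives \<open>\<langle>\<phi> u, v\<rangle> = \<langle>a z ^ m u, z ^ n v\<rangle>\<close>, an inner product of two
functions in the Bergman space again.  Reading it in coefficients shows that \<open>T\<^sub>\<phi>\<close> is the weighted shift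
\<open>toeplitz_seq a m n\<close>, which sends \<open>z ^ j\<close> to \<open>a (k + 1) / (k + n + 1) z ^ k\<close> with \<open>k = j + m - n\<close>, and to
\<open>0\<close> when \<open>j + m < n\<close>.  In the same way the adjoint is the Toeplitz operator of the conjugate symbol, that
is \<open>toeplitz_seq (cnj a) n m\<close>.  This also provides the orthogonal projection of \<open>\<phi> u\<close> and the adjoint
explicitly, so that no general theorem on Hilbert spaces enters
(\<open>toeplitz_disc_series\<close>, \<open>L2_inner_toeplitz_adjoint\<close>).

Hyponormality now says that \<open>\<parallel>T\<^sub>\<phi> u\<parallel> \<ge> \<parallel>T\<^sub>\<phi>\<^sup>* u\<parallel>\<close> for all \<open>u\<close>.  Both weighted shifts map distinct monomials
to orthogonal vectors, so each square norm is a sum over the coefficients of \<open>u\<close>.  With \<open>d = m - n\<close>,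
the comparison for the coefficient of \<open>z ^ (k + d)\<close> is the elementary inequality
\<open>(k + 1) / (k + m + 1)\<^sup>2 \<le> (k + 2 d + 1) / (k + m + d + 1)\<^sup>2\<close>; the first \<open>d\<close> coefficients contribute only
to \<open>\<parallel>T\<^sub>\<phi> u\<parallel>\<close>, since the adjoint lowers degrees by \<open>d\<close> (\<open>weight_inequality\<close>, \<open>seq_energy_toeplitz_le\<close>).
\<close>

section \<open>Complex multiplication and area\<close>

text \<open>
The change-of-variables formula for linear maps is stated for \<open>real ^ 'n\<close>; this isomorphism carries
it over to the complex plane.
\<close>

definition vec2_to_complex :: "real^2 \<Rightarrow> complex" where
  "vec2_to_complex v = Complex (v $ 1) (v $ 2)"

lemma vec2_to_complex_measurable [measurable]: "vec2_to_complex \<in> borel_measurable borel"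
proof -
  have "continuous_on UNIV vec2_to_complex"
    unfolding vec2_to_complex_def Complex_eq by (intro continuous_intros)
  then show ?thesis by (rule borel_measurable_continuous_onI)
qed

lemma box_complex_iff: "z \<in> box l u \<longleftrightarrow> Re l < Re z \<and> Re z < Re u \<and> Im l < Im z \<and> Im z < Im u"
  by (auto simp: mem_box Basis_complex_def)

lemma distr_vec2_to_complex: "lborel = distr lborel borel vec2_to_complex"
proof (rule lborel_eqI)
  fix l u :: complex
  assume le: "\<And>b. b \<in> Basis \<Longrightarrow> l \<bullet> b \<le> u \<bullet> b"
  have "vec2_to_complex -` box l u = box (vector [Re l, Im l]) (vector [Re u, Im u])"
    by (auto simp: vec2_to_complex_def box_complex_iff mem_box_cart forall_2)
  moreover have "emeasure lborel (box (vector [Re l, Im l]) (vector [Re u, Im u] :: real^2))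
      = ennreal ((Re u - Re l) * (Im u - Im l))"
    using le[of 1] le[of \<i>]
    by (subst emeasure_lborel_box) (auto simp: Basis_vec_def cart_eq_inner_axis[symmetric] forall_2 Basis_complex_def
        axis_eq_axis inner_axis UNIV_2 prod.union_disjoint)
  ultimately show "emeasure (distr lborel borel vec2_to_complex) (box l u)
      = (\<Prod>b\<in>Basis. (u - l) \<bullet> b)"
    by (simp add: emeasure_distr Basis_complex_def)
qed simp

text \<open>
Multiplication by \<open>w\<close> is, in real coordinates, a linear map with determinant \<open>\<bar>w\<bar>\<^sup>2\<close>.  One statement
serves both for rotations (orthogonality of the monomials) and for dilations (their norms).
\<close>

lemma lborel_complex_mult:
  fixes w :: complex
  assumes "w \<noteq> 0"
  shows "lborel = density (distr lborel borel ((*) w)) (\<lambda>_. ennreal ((cmod w)\<^sup>2))"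
proof (rule lborel_eqI)
  fix l u :: complex
  assume le: "\<And>b. b \<in> Basis \<Longrightarrow> l \<bullet> b \<le> u \<bullet> b"
  \<comment> \<open>The preimage of a box under multiplication by w is its image under multiplication by v.\<close>
  define v where "v = inverse w"
  define g :: "real^2 \<Rightarrow> real^2" where
    "g x = vector [Re v * x$1 - Im v * x$2, Im v * x$1 + Re v * x$2]" for x
  have g: "vec2_to_complex (g x) = v * vec2_to_complex x" for x
    by (simp add: vec2_to_complex_def g_def complex_eq_iff)
  have wv: "w * (v * z) = z" for z
    using assms by (simp add: v_def)
  have inj: "x = y" if "vec2_to_complex x = vec2_to_complex y" for x y
    using that by (simp add: vec2_to_complex_def vec_eq_iff forall_2)
  define S where "S = vec2_to_complex -` box l u"
  have S: "x \<in> S \<longleftrightarrow> vec2_to_complex x \<in> box l u" for x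
    by (simp add: S_def)
  have lin: "linear g"
    by (rule linearI) (simp_all add: g_def vec_eq_iff forall_2 algebra_simps)
  have det: "det (matrix g) = (cmod v)\<^sup>2"
    by (simp add: det_2 matrix_def g_def axis_def cmod_def power2_eq_square)
  have eq: "vec2_to_complex -` ((*) w -` box l u) = g ` S"
  proof (intro equalityI subsetI)
    fix x assume x: "x \<in> vec2_to_complex -` ((*) w -` box l u)"
    define y :: "real^2" where "y = vector [Re (w * vec2_to_complex x), Im (w * vec2_to_complex x)]"
    have y: "vec2_to_complex y = w * vec2_to_complex x"
      by (simp add: y_def vec2_to_complex_def complex_eq_iff)
    then have "g y = x"
      using assms by (intro inj) (simp add: g v_def)
    moreover have "y \<in> S" using x y S by simp
    ultimately show "x \<in> g ` S" by blast
  qed (auto simp: g S wv)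
  have preim: "(*) w -` box l u \<in> sets borel"
    using measurable_sets_borel[of "(*) w" borel "box l u"] by simp
  have S_borel: "S \<in> sets borel"
    unfolding S_def using measurable_sets_borel[OF vec2_to_complex_measurable, of "box l u"] by simp
  have "emeasure lborel S = emeasure (distr lborel borel vec2_to_complex) (box l u)"
    by (simp add: emeasure_distr S_def)
  then have "emeasure lborel S = emeasure lborel (box l u)"
    by (simp add: distr_vec2_to_complex[symmetric])
  then have S_emeas: "emeasure lebesgue S = emeasure lborel (box l u)"
    using S_borel by simp
  then have S_lmeas: "S \<in> lmeasurable"
    using S_borel emeasure_lborel_box_finite[of l u] by (intro fmeasurableI) auto
  have "emeasure lborel ((*) w -` box l u) = emeasure lborel (vec2_to_complex -` ((*) w -` box l u))"
    using emeasure_distr[of vec2_to_complex lborel borel "(*) w -` box l u"] preim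
    by (simp add: distr_vec2_to_complex[symmetric])
  also have "\<dots> = emeasure lebesgue (g ` S)"
    unfolding eq[symmetric]
    using measurable_sets_borel[OF vec2_to_complex_measurable preim] by simp
  also have "\<dots> = ennreal ((cmod v)\<^sup>2 * measure lebesgue S)"
    using measurable_linear_image[OF lin S_lmeas] measure_linear_image[OF lin S_lmeas] 
    by (simp add: emeasure_eq_measure2 det)
  also have "measure lebesgue S = (Re u - Re l) * (Im u - Im l)"
  proof -
    have "measure lebesgue S = measure lborel (box l u)"
      by (simp only: measure_def S_emeas)
    also have "\<dots> = (Re u - Re l) * (Im u - Im l)"
      by (subst measure_lborel_box[OF le]) (auto simp: Basis_complex_def)
    finally show ?thesis .
  qed
  finally have *: "emeasure lborel ((*) w -` box l u) = ennreal ((cmod v)\<^sup>2 * ((Re u - Re l) * (Im u - Im l)))" .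
  have "emeasure (density (distr lborel borel ((*) w)) (\<lambda>_. ennreal ((cmod w)\<^sup>2))) (box l u)
     = ennreal ((cmod w)\<^sup>2) * emeasure lborel ((*) w -` box l u)"
    by (simp add: emeasure_density nn_integral_cmult emeasure_distr)
  also have "\<dots> = ennreal ((cmod w)\<^sup>2 * ((cmod v)\<^sup>2 * ((Re u - Re l) * (Im u - Im l))))"
    unfolding * by (simp add: ennreal_mult')
  also have "(cmod w)\<^sup>2 * ((cmod v)\<^sup>2 * ((Re u - Re l) * (Im u - Im l))) = (\<Prod>b\<in>Basis. (u - l) \<bullet> b)"
    using assms by (simp add: v_def Basis_complex_def norm_inverse power_inverse)
  finally show "emeasure (density (distr lborel borel ((*) w)) (\<lambda>_. ennreal ((cmod w)\<^sup>2))) (box l u)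
      = (\<Prod>b\<in>Basis. (u - l) \<bullet> b)" .
qed simp

lemma integral_complex_mult:
  fixes f :: "complex \<Rightarrow> complex"
  assumes w: "w \<noteq> 0" and f [measurable]: "f \<in> borel_measurable borel"
  shows "(LINT z|lborel. f z) = (cmod w)\<^sup>2 *\<^sub>R (LINT z|lborel. f (w * z))"
proof -
  have "(LINT z|lborel. f z) = (LINT z|density (distr lborel borel ((*) w)) (\<lambda>_. ennreal ((cmod w)\<^sup>2)). f z)"
    using lborel_complex_mult[OF w] by simp
  also have "\<dots> = (LINT z|distr lborel borel ((*) w). (cmod w)\<^sup>2 *\<^sub>R f z)"
    by (intro integral_density) auto
  also have "\<dots> = (cmod w)\<^sup>2 *\<^sub>R (LINT z|lborel. f (w * z))"
    by (subst integral_distr) auto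
  finally show ?thesis .
qed

section \<open>Moments of discs\<close>

definition disc_moment :: "real \<Rightarrow> nat \<Rightarrow> nat \<Rightarrow> complex" where
  "disc_moment r j k = (LINT z|lborel. indicator (ball 0 r) z *\<^sub>R (z ^ j * cnj z ^ k))"

lemma integrable_indicator_ball_continuous:
  fixes f :: "complex \<Rightarrow> 'a::{banach, second_countable_topology}"
  assumes "continuous_on UNIV f"
  shows "integrable lborel (\<lambda>z. indicator (ball 0 r) z *\<^sub>R f z)"
proof -
  have "integrable lborel (\<lambda>z. indicator (cball 0 r) z *\<^sub>R f z)"
    by (intro borel_integrable_compact continuous_on_subset[OF assms]) auto
  then have "integrable lborel (\<lambda>z. indicator (ball 0 r) z *\<^sub>R (indicator (cball 0 r) z *\<^sub>R f z))"
    by (rule integrable_mult_indicator[rotated]) auto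
  moreover have "indicator (ball 0 r) z *\<^sub>R (indicator (cball 0 r) z *\<^sub>R f z) = indicator (ball 0 r) z *\<^sub>R f z" for z
    by (auto simp: indicator_def)
  ultimately show ?thesis by (simp only:)
qed

text \<open>
Substitute \<open>w * z\<close> for \<open>z\<close>: the integrand is homogeneous in \<open>z\<close> and in \<open>cnj z\<close>.
\<close>

lemma disc_moment_mult:
  assumes "w \<noteq> 0"
  shows "disc_moment (cmod w * r) j k = (cmod w)\<^sup>2 *\<^sub>R (w ^ j * cnj w ^ k * disc_moment r j k)"
proof -
  have *: "indicator (ball 0 (cmod w * r)) (w * z) *\<^sub>R ((w * z) ^ j * cnj (w * z) ^ k)
      = w ^ j * cnj w ^ k * (indicator (ball 0 r) z *\<^sub>R (z ^ j * cnj z ^ k))" for z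
    using assms by (simp add: indicator_def norm_mult power_mult_distrib)
  have [measurable]: "(\<lambda>z. indicator (ball 0 R) z *\<^sub>R (z ^ j * cnj z ^ k)) \<in> borel_measurable borel" for R :: real
    by (intro borel_measurable_scaleR borel_measurable_indicator borel_measurable_continuous_onI continuous_intros) auto
  show ?thesis
    unfolding disc_moment_def
    by (subst integral_complex_mult[OF assms]) (simp_all only: * integral_mult_right_zero, measurable)
qed

text \<open>
The rotation by the angle \<open>\<pi> / (j - k)\<close> preserves the disc and multiplies the integrand by \<open>-1\<close>.
\<close>

lemma disc_moment_orthogonal:
  assumes "j \<noteq> k"
  shows "disc_moment r j k = 0"
proof -
  define w where "w = cis (pi / (real j - real k))"
  have "w ^ j * cnj w ^ k = cis (real j * (pi / (real j - real k)) - real k * (pi / (real j - real k)))"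
    by (simp only: w_def cis_cnj Complex.DeMoivre cis_mult mult_minus_right diff_conv_add_uminus)
  also have "real j * (pi / (real j - real k)) - real k * (pi / (real j - real k)) = pi"
    using assms by (simp only: left_diff_distrib[symmetric]) simp
  finally have "w ^ j * cnj w ^ k = -1" by simp
  moreover have "w \<noteq> 0" "cmod w = 1" by (simp_all add: w_def)
  ultimately have "disc_moment r j k = - disc_moment r j k"
    using disc_moment_mult[of w r j k] by simp
  then show ?thesis by simp
qed

text \<open>
Polar coordinates are avoided by a dilation argument.  Let \<open>m r\<close> be the integral of \<open>\<bar>z\<bar> ^ (2 k)\<close> over the
disc of radius \<open>r\<close>.  By homogeneity \<open>m 1 - m r = m 1 (1 - r ^ (2 k + 2))\<close>, while this difference is an
integral over an annulus of area \<open>\<pi> (1 - r\<^sup>2)\<close> on which the integrand lies between \<open>r ^ (2 k)\<close> and \<open>1\<close>.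
Dividing by \<open>1 - r\<^sup>2\<close> and letting \<open>r\<close> tend to \<open>1\<close> gives \<open>m 1 (k + 1) = \<pi>\<close>.
\<close>

lemma disc_moment_unit:
  "disc_moment 1 k k = of_real (pi / (real k + 1))"
proof -
  define m where "m r = (LINT z|lborel. indicator (ball (0::complex) r) z * (cmod z) ^ (2 * k))" for r :: real
  have int: "integrable lborel (\<lambda>z. indicator (ball (0::complex) r) z * (cmod z) ^ (2 * k))" for r
    using integrable_indicator_ball_continuous[of "\<lambda>z. (cmod z) ^ (2 * k)" r]
    by (simp add: continuous_intros)
  have dm: "disc_moment r k k = of_real (m r)" for r
  proof -
    have "indicator (ball 0 r) z *\<^sub>R (z ^ k * cnj z ^ k) = of_real (indicator (ball 0 r) z * (cmod z) ^ (2 * k))" for z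
      by (simp add: scaleR_conv_of_real power_mult complex_norm_square[symmetric] power_mult_distrib[symmetric])
    then show ?thesis unfolding disc_moment_def m_def
      by (simp only: integral_complex_of_real)
  qed
  have area: "measure lborel (ball (0::complex) r) = pi * r\<^sup>2" if "r \<ge> 0" for r
    using content_ball[of r "0::complex"] that by (simp add: unit_ball_vol_2)
  have scale: "m r = r ^ (2 * k + 2) * m 1" if "r > 0" for r
  proof -
    \<comment> \<open>A dilation by r contributes r ^ (2 k) from the integrand and r ^ 2 from the area.\<close>
    have "complex_of_real (m r) = of_real (r ^ (2 * k + 2) * m 1)"
      using disc_moment_mult[of "of_real r" 1 k k] that
      by (simp add: dm scaleR_conv_of_real power_mult_distrib power_add power_mult power2_eq_square mult_ac)
    then show ?thesis by (simp only: of_real_eq_iff)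
  qed
  have annulus: "r ^ (2 * k) * (pi * (1 - r\<^sup>2)) \<le> m 1 - m r \<and> m 1 - m r \<le> pi * (1 - r\<^sup>2)"
    if r: "0 < r" "r < 1" for r
  proof -
    define A where "A = ball (0::complex) 1 - ball 0 r"
    have A: "A \<in> sets lborel" "emeasure lborel A < \<infinity>"
      using le_less_trans[OF emeasure_mono[of A "ball 0 1" lborel] emeasure_lborel_ball_finite]
      by (auto simp: A_def)
    have mA: "measure lborel A = pi * (1 - r\<^sup>2)"
      unfolding A_def using r emeasure_lborel_ball_finite[of "0::complex" 1]
      by (subst measure_Diff) (auto simp: area algebra_simps)
    have intA: "integrable lborel (\<lambda>z. indicator A z * c)" for c :: real
      using A by simp
    have "m 1 - m r = (LINT z|lborel. indicator (ball (0::complex) 1) z * (cmod z) ^ (2 * k) - indicator (ball (0::complex) r) z * (cmod z) ^ (2 * k))"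
      unfolding m_def using int by simp
    also have "\<dots> = (LINT z|lborel. indicator A z * (cmod z) ^ (2 * k))"
      using r by (intro Bochner_Integration.integral_cong) (auto simp: A_def indicator_def)
    finally have m: "m 1 - m r = (LINT z|lborel. indicator A z * (cmod z) ^ (2 * k))" .
    have intm: "integrable lborel (\<lambda>z. indicator A z * (cmod z) ^ (2 * k))"
    proof -
      have "integrable lborel (\<lambda>z. indicator (ball (0::complex) 1) z * (cmod z) ^ (2 * k) - indicator (ball (0::complex) r) z * (cmod z) ^ (2 * k))"
        using int by simp
      moreover have "indicator (ball (0::complex) 1) z * (cmod z) ^ (2 * k) - indicator (ball (0::complex) r) z * (cmod z) ^ (2 * k) = indicator A z * (cmod z) ^ (2 * k)" for z
        using r by (auto simp: A_def indicator_def)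
      ultimately show ?thesis by simp
    qed
    have "(LINT z|lborel. indicator A z * r ^ (2 * k)) \<le> m 1 - m r"
      unfolding m using r by (intro integral_mono intA intm) (auto simp: indicator_def A_def intro!: power_mono)
    moreover have "m 1 - m r \<le> (LINT z|lborel. indicator A z * 1)"
      unfolding m by (intro integral_mono intA intm) (auto simp: indicator_def A_def intro!: power_le_one)
    ultimately show ?thesis using mA A by (simp add: mult_ac)
  qed
  have bounds: "r ^ (2 * k) * pi \<le> m 1 * (\<Sum>i<Suc k. (r\<^sup>2) ^ i) \<and> m 1 * (\<Sum>i<Suc k. (r\<^sup>2) ^ i) \<le> pi"
    if r: "0 < r" "r < 1" for r
  proof -
    have pos: "1 - r\<^sup>2 > 0" using r by (simp add: power_less_one_iff abs_square_less_1)
    have "m 1 - m r = m 1 * (1 - (r\<^sup>2) ^ Suc k)"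
    proof -
      have "(r\<^sup>2) ^ Suc k = r ^ (2 * k + 2)" by (simp only: power_mult[symmetric] mult_Suc_right add.commute)
      then show ?thesis
        unfolding scale[OF r(1)] by (simp only: right_diff_distrib mult_1_right mult.commute)
    qed
    also have "1 - (r\<^sup>2) ^ Suc k = (1 - r\<^sup>2) * (\<Sum>i<Suc k. (r\<^sup>2) ^ i)"
      by (rule one_diff_power_eq)
    finally have eq: "m 1 - m r = (1 - r\<^sup>2) * (m 1 * (\<Sum>i<Suc k. (r\<^sup>2) ^ i))" 
      by (simp only: mult_ac)
    have "(1 - r\<^sup>2) * (r ^ (2 * k) * pi) \<le> (1 - r\<^sup>2) * (m 1 * (\<Sum>i<Suc k. (r\<^sup>2) ^ i))"
      "(1 - r\<^sup>2) * (m 1 * (\<Sum>i<Suc k. (r\<^sup>2) ^ i)) \<le> (1 - r\<^sup>2) * pi"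
      using annulus[OF r] unfolding eq by (simp_all only: mult_ac)
    then show ?thesis using pos by (simp only: mult_le_cancel_left_pos)
  qed
  have ev: "eventually (\<lambda>r. 0 < r \<and> r < 1) (at_left (1::real))"
    using eventually_at_left_real[of 0 1] by (auto elim: eventually_mono)
  have lim1: "((\<lambda>r. m 1 * (\<Sum>i<Suc k. (r\<^sup>2) ^ i)) \<longlongrightarrow> pi) (at_left 1)"
  proof (rule tendsto_sandwich[OF _ _ _ tendsto_const])
    show "((\<lambda>r. r ^ (2 * k) * pi) \<longlongrightarrow> pi) (at_left 1)"
      by (rule tendsto_eq_intros refl | simp)+
    show "\<forall>\<^sub>F r in at_left 1. r ^ (2 * k) * pi \<le> m 1 * (\<Sum>i<Suc k. (r\<^sup>2) ^ i)"
      using ev by eventually_elim (use bounds in blast)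
    show "\<forall>\<^sub>F r in at_left 1. m 1 * (\<Sum>i<Suc k. (r\<^sup>2) ^ i) \<le> pi"
      using ev by eventually_elim (use bounds in blast)
  qed
  have lim2: "((\<lambda>r. m 1 * (\<Sum>i<Suc k. (r\<^sup>2) ^ i)) \<longlongrightarrow> m 1 * (\<Sum>i<Suc k. (1\<^sup>2) ^ i)) (at_left 1)"
    by (intro tendsto_intros)
  have "m 1 * (\<Sum>i<Suc k. (1\<^sup>2) ^ i) = pi"
    by (rule tendsto_unique[OF _ lim2 lim1]) simp
  then have "m 1 * (real k + 1) = pi" by (simp add: add.commute)
  then have "m 1 = pi / (real k + 1)" by (simp add: nonzero_eq_divide_eq)
  then show ?thesis by (simp only: dm)
qed

lemma disc_moment_diag:
  assumes "r > 0"
  shows "disc_moment r k k = of_real (pi / (real k + 1) * r ^ (2 * k + 2))"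
  using disc_moment_mult[of "of_real r" 1 k k] assms
  by (simp add: disc_moment_unit scaleR_conv_of_real power_add power_mult power2_eq_square power_mult_distrib mult_ac)

section \<open>The norm of a power series on the disc\<close>

lemma integral_disc_partial_sum:
  assumes r: "0 < r"
  shows "(LINT z|lborel. indicator (ball 0 r) z * (cmod (\<Sum>k<N. c k * z ^ k))\<^sup>2)
       = (\<Sum>k<N. (cmod (c k))\<^sup>2 * (pi / (real k + 1) * r ^ (2 * k + 2)))" (is "?L = ?R")
proof -
  let ?e = "\<lambda>j k z. indicator (ball 0 r) z *\<^sub>R (z ^ j * cnj z ^ k) :: complex"
  have int: "integrable lborel (?e j k)" for j k
    by (intro integrable_indicator_ball_continuous continuous_intros)
  have "complex_of_real (indicator (ball 0 r) z * (cmod (\<Sum>k<N. c k * z ^ k))\<^sup>2)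
      = (\<Sum>j<N. \<Sum>k<N. (c j * cnj (c k)) * ?e j k z)" for z
    unfolding of_real_mult complex_norm_square cnj_sum sum_product
    unfolding sum_distrib_left
    by (intro sum.cong refl) (simp add: scaleR_conv_of_real mult_ac)
  then have "complex_of_real ?L = (LINT z|lborel. (\<Sum>j<N. \<Sum>k<N. (c j * cnj (c k)) * ?e j k z))"
    by (simp only: integral_complex_of_real[symmetric])
  also have "\<dots> = (\<Sum>j<N. \<Sum>k<N. (c j * cnj (c k)) * disc_moment r j k)"
  proof -
    have int': "integrable lborel (\<lambda>z. (c j * cnj (c k)) * ?e j k z)" for j k
      using int by (rule integrable_mult_right)
    have "(LINT z|lborel. (\<Sum>j<N. \<Sum>k<N. (c j * cnj (c k)) * ?e j k z))
        = (\<Sum>j<N. LINT z|lborel. (\<Sum>k<N. (c j * cnj (c k)) * ?e j k z))"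
      by (intro Bochner_Integration.integral_sum Bochner_Integration.integrable_sum int')
    also have "\<dots> = (\<Sum>j<N. \<Sum>k<N. LINT z|lborel. (c j * cnj (c k)) * ?e j k z)"
      by (intro sum.cong refl Bochner_Integration.integral_sum int')
    finally show ?thesis
      by (simp only: integral_mult_right_zero disc_moment_def)
  qed
  also have "\<dots> = (\<Sum>j<N. \<Sum>k<N. if k = j then (c j * cnj (c j)) * disc_moment r j j else 0)"
    by (intro sum.cong refl) (auto simp: disc_moment_orthogonal)
  also have "\<dots> = (\<Sum>j<N. (c j * cnj (c j)) * disc_moment r j j)"
    by simp
  also have "\<dots> = complex_of_real ?R"
    using r by (simp add: disc_moment_diag complex_norm_square del: of_real_power)
  finally show ?thesis by (simp only: of_real_eq_iff)
qed

text \<open>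
On a smaller disc the partial sums are dominated by the constant \<open>K = \<Sum>k. \<bar>c k\<bar> r ^ k\<close>, so the
identity for polynomials passes to the limit.
\<close>

lemma nn_integral_disc_power_series_radius:
  assumes r: "0 < r" "r < 1"
    and f: "\<And>z. z \<in> \<bbbD> \<Longrightarrow> (\<lambda>k. c k * z ^ k) sums f z"
  shows "(\<integral>\<^sup>+z. ennreal ((cmod (f z))\<^sup>2) * indicator (ball 0 r) z \<partial>lborel)
       = (\<Sum>k. ennreal ((cmod (c k))\<^sup>2 * (pi / (real k + 1) * r ^ (2 * k + 2))))"
proof -
  define F where "F N z = indicator (ball 0 r) z * (cmod (\<Sum>k<N. c k * z ^ k))\<^sup>2" for N z
  define G where "G z = indicator (ball 0 r) z * (cmod (f z))\<^sup>2" for z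
  \<comment> \<open>The series converges at the point (1 + r) / 2 between r and 1, hence absolutely at r.\<close>
  have sm: "summable (\<lambda>k. cmod (c k) * r ^ k)"
  proof -
    have "((of_real ((1 + r) / 2)) :: complex) \<in> \<bbbD>"
      using r by (simp only: mem_ball_0 norm_of_real) simp
    then have "summable (\<lambda>k. c k * (of_real ((1 + r) / 2)) ^ k)"
      using f sums_summable by blast
    then have "summable (\<lambda>k. norm (c k * (of_real r) ^ k))"
      by (rule powser_insidea) (use r in \<open>simp only: norm_of_real\<close>, simp)
    then show ?thesis using r by (simp add: norm_mult norm_power)
  qed
  define K where "K = (\<Sum>k. cmod (c k) * r ^ k)"
  have [measurable]: "F N \<in> borel_measurable borel" for N
    unfolding F_def by (intro borel_measurable_times borel_measurable_indicator borel_measurable_continuous_onI continuous_intros) auto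
  have lim: "(\<lambda>N. F N z) \<longlonglongrightarrow> G z" for z
  proof (cases "z \<in> ball 0 r")
    case True
    then have "z \<in> \<bbbD>" using r by simp
    then have "(\<lambda>N. \<Sum>k<N. c k * z ^ k) \<longlonglongrightarrow> f z" using f by (simp add: sums_def)
    then show ?thesis unfolding F_def G_def by (intro tendsto_intros)
  qed (simp add: F_def G_def)
  have [measurable]: "G \<in> borel_measurable borel"
    by (rule borel_measurable_LIMSEQ_real[OF lim]) measurable
  have bound: "norm (F N z) \<le> indicator (ball 0 r) z * K\<^sup>2" for N z
  proof (cases "z \<in> ball 0 r")
    case True
    have "cmod (\<Sum>k<N. c k * z ^ k) \<le> (\<Sum>k<N. cmod (c k) * r ^ k)"
      using True by (intro sum_norm_le) (auto simp: norm_mult norm_power intro!: mult_left_mono power_mono)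
    also have "\<dots> \<le> K" unfolding K_def
      using r by (intro sum_le_suminf sm) auto
    finally show ?thesis using True by (simp add: F_def power_mono)
  qed (simp add: F_def)
  have intK: "integrable lborel (\<lambda>z. indicator (ball (0::complex) r) z * K\<^sup>2)"
    using integrable_indicator_ball_continuous[of "\<lambda>z. K\<^sup>2" r] by simp
  have G: "integrable lborel G"
    by (rule integrable_dominated_convergence[where s = F and w = "\<lambda>z. indicator (ball 0 r) z * K\<^sup>2"])
       (use lim bound intK in auto)
  have "(\<lambda>N. LINT z|lborel. F N z) \<longlonglongrightarrow> (LINT z|lborel. G z)"
    by (rule integral_dominated_convergence[where w = "\<lambda>z. indicator (ball 0 r) z * K\<^sup>2"])
       (use lim bound intK in auto)
  then have sums: "(\<lambda>k. (cmod (c k))\<^sup>2 * (pi / (real k + 1) * r ^ (2 * k + 2))) sums (LINT z|lborel. G z)"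
    unfolding F_def integral_disc_partial_sum[OF r(1)] by (simp only: sums_def)
  have "(\<integral>\<^sup>+z. ennreal ((cmod (f z))\<^sup>2) * indicator (ball 0 r) z \<partial>lborel) = (\<integral>\<^sup>+z. ennreal (G z) \<partial>lborel)"
    by (intro nn_integral_cong) (auto simp: G_def indicator_def)
  also have "\<dots> = ennreal (LINT z|lborel. G z)"
    by (rule nn_integral_eq_integral[OF G]) (simp add: G_def)
  also have "\<dots> = (\<Sum>k. ennreal ((cmod (c k))\<^sup>2 * (pi / (real k + 1) * r ^ (2 * k + 2))))"
    using r sums by (intro suminf_ennreal_eq[symmetric]) auto
  finally show ?thesis .
qed

text \<open>
Monotone convergence on both sides as the radius increases to \<open>1\<close>.  Since the integral may be
infinite here, the identity decides in both directions whether a power series is square integrable.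
\<close>

lemma nn_integral_disc_power_series:
  assumes f: "\<And>z. z \<in> \<bbbD> \<Longrightarrow> (\<lambda>k. c k * z ^ k) sums f z"
    and hol: "f holomorphic_on \<bbbD>"
  shows "(\<integral>\<^sup>+z. ennreal ((cmod (f z))\<^sup>2) \<partial>lebesgue_on \<bbbD>)
       = (\<Sum>k. ennreal ((cmod (c k))\<^sup>2 * (pi / (real k + 1))))"
proof -
  \<comment> \<open>Any radii in the open unit interval that increase to 1 serve.\<close>
  define r where "r i = 1 - inverse (real i + 2)" for i
  have r: "0 < r i" "r i < 1" for i by (simp_all add: r_def field_simps)
  have r_mono: "incseq r" by (auto simp: incseq_def r_def field_simps)
  have r_lim: "r \<longlonglongrightarrow> 1" unfolding r_def by real_asymp
  have fm: "(\<lambda>z. indicator \<bbbD> z *\<^sub>R f z) \<in> borel_measurable borel"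
    by (rule borel_measurable_continuous_on_indicator) (use hol holomorphic_on_imp_continuous_on in auto)
  have [measurable]: "ball (0::complex) (r i) \<in> sets borel" for i
    by simp
  have m: "(\<lambda>z. ennreal ((cmod (f z))\<^sup>2) * indicator (ball 0 (r i)) z) \<in> borel_measurable lborel" for i
  proof -
    have "(\<lambda>z. ennreal ((cmod (indicator \<bbbD> z *\<^sub>R f z))\<^sup>2) * indicator (ball 0 (r i)) z) \<in> borel_measurable lborel"
      using fm by measurable
    moreover have "ennreal ((cmod (indicator \<bbbD> z *\<^sub>R f z))\<^sup>2) * indicator (ball 0 (r i)) z
        = ennreal ((cmod (f z))\<^sup>2) * indicator (ball 0 (r i)) z" for z
      using r[of i] by (auto simp: indicator_def)
    ultimately show ?thesis by (simp only:)
  qed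
  have sup1: "(SUP i. ennreal ((cmod (f z))\<^sup>2) * indicator (ball 0 (r i)) z) = ennreal ((cmod (f z))\<^sup>2) * indicator \<bbbD> z" for z
  proof -
    have "(SUP i. indicator (ball 0 (r i)) z) = (indicator (\<Union>i. ball 0 (r i)) z :: ennreal)"
      by (auto simp: indicator_def intro!: antisym SUP_least SUP_upper2)
    also have "(\<Union>i. ball 0 (r i)) = \<bbbD>"
    proof (intro equalityI subsetI)
      fix z :: complex assume "z \<in> \<bbbD>"
      then have "eventually (\<lambda>i. cmod z < r i) sequentially"
        using order_tendstoD(1)[OF r_lim] by simp
      then show "z \<in> (\<Union>i. ball 0 (r i))" by (auto simp: eventually_sequentially)
    qed (use r in \<open>auto intro: less_trans\<close>)
    finally show ?thesis by (simp add: SUP_mult_left_ennreal[symmetric])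
  qed
  have mono: "incseq (\<lambda>i. ennreal ((cmod (c k))\<^sup>2 * (pi / (real k + 1) * r i ^ (2 * k + 2))))" for k
    unfolding incseq_def
    by (intro allI impI ennreal_leI mult_left_mono power_mono) (use r_mono r in \<open>auto simp: incseq_def less_imp_le\<close>)
  have sup2: "(SUP i. ennreal ((cmod (c k))\<^sup>2 * (pi / (real k + 1) * r i ^ (2 * k + 2))))
      = ennreal ((cmod (c k))\<^sup>2 * (pi / (real k + 1)))" for k
  proof (rule LIMSEQ_unique[OF LIMSEQ_SUP[OF mono]])
    have "(\<lambda>i. (cmod (c k))\<^sup>2 * (pi / (real k + 1) * r i ^ (2 * k + 2)))
        \<longlonglongrightarrow> (cmod (c k))\<^sup>2 * (pi / (real k + 1) * 1 ^ (2 * k + 2))"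
      by (intro tendsto_intros r_lim)
    then show "(\<lambda>i. ennreal ((cmod (c k))\<^sup>2 * (pi / (real k + 1) * r i ^ (2 * k + 2))))
        \<longlonglongrightarrow> ennreal ((cmod (c k))\<^sup>2 * (pi / (real k + 1)))"
      by (intro tendsto_ennrealI) simp
  qed
  have "(\<integral>\<^sup>+z. ennreal ((cmod (f z))\<^sup>2) \<partial>lebesgue_on \<bbbD>)
      = (\<integral>\<^sup>+z. ennreal ((cmod (f z))\<^sup>2) * indicator \<bbbD> z \<partial>lborel)"
    by (simp add: nn_integral_restrict_space nn_integral_completion)
  also have "\<dots> = (SUP i. \<integral>\<^sup>+z. ennreal ((cmod (f z))\<^sup>2) * indicator (ball 0 (r i)) z \<partial>lborel)"
    unfolding sup1[symmetric]
  proof (rule nn_integral_monotone_convergence_SUP)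
    show "incseq (\<lambda>i z. ennreal ((cmod (f z))\<^sup>2) * indicator (ball 0 (r i)) z)"
      using r_mono by (auto simp: incseq_def le_fun_def indicator_def intro: less_le_trans)
  qed (rule m)
  also have "\<dots> = (SUP i. \<Sum>k. ennreal ((cmod (c k))\<^sup>2 * (pi / (real k + 1) * r i ^ (2 * k + 2))))"
    using nn_integral_disc_power_series_radius[OF r f] by simp
  also have "\<dots> = (\<Sum>k. SUP i. ennreal ((cmod (c k))\<^sup>2 * (pi / (real k + 1) * r i ^ (2 * k + 2))))"
    by (rule ennreal_suminf_SUP_eq[OF mono, symmetric])
  also have "\<dots> = (\<Sum>k. ennreal ((cmod (c k))\<^sup>2 * (pi / (real k + 1))))"
    by (simp only: sup2)
  finally show ?thesis .
qed

section \<open>The Bergman space as a weighted sequence space\<close>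

text \<open>
The Taylor coefficients of the functions in the Bergman space.
\<close>

definition bergman_seqs :: "(nat \<Rightarrow> complex) set" where
  "bergman_seqs = {c. summable (\<lambda>k. (cmod (c k))\<^sup>2 / (real k + 1))}"

text \<open>
The square norm in the Bergman space divided by \<open>\<pi>\<close>.
\<close>

definition seq_energy :: "(nat \<Rightarrow> complex) \<Rightarrow> real" where
  "seq_energy c = (\<Sum>k. (cmod (c k))\<^sup>2 / (real k + 1))"

text \<open>
The value \<open>0\<close> off the disc matches the normalisation in \<^const>\<open>bergman_space\<close>.
\<close>

definition disc_series :: "(nat \<Rightarrow> complex) \<Rightarrow> complex \<Rightarrow> complex" where
  "disc_series c z = (if z \<in> \<bbbD> then \<Sum>k. c k * z ^ k else 0)"

lemma norm_sum_square_le: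
  fixes x y :: complex
  shows "(cmod (x + y))\<^sup>2 \<le> 2 * (cmod x)\<^sup>2 + 2 * (cmod y)\<^sup>2"
proof -
  have "(cmod (x + y))\<^sup>2 \<le> (cmod x + cmod y)\<^sup>2"
    by (intro power_mono norm_triangle_ineq) simp
  also have "\<dots> \<le> 2 * (cmod x)\<^sup>2 + 2 * (cmod y)\<^sup>2"
    using sum_squares_bound[of "cmod x" "cmod y"] by (simp add: power2_sum)
  finally show ?thesis .
qed

lemma bergman_seqs_add:
  assumes "c \<in> bergman_seqs" "d \<in> bergman_seqs"
  shows "(\<lambda>k. c k + d k) \<in> bergman_seqs"
proof -
  have "summable (\<lambda>k. 2 * ((cmod (c k))\<^sup>2 / (real k + 1)) + 2 * ((cmod (d k))\<^sup>2 / (real k + 1)))"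
    using assms unfolding bergman_seqs_def by (intro summable_add summable_mult) auto
  moreover have "norm ((cmod (c k + d k))\<^sup>2 / (real k + 1))
      \<le> 2 * ((cmod (c k))\<^sup>2 / (real k + 1)) + 2 * ((cmod (d k))\<^sup>2 / (real k + 1))" for k
    using norm_sum_square_le[of "c k" "d k"] by (simp add: divide_simps)
  ultimately show ?thesis
    unfolding bergman_seqs_def mem_Collect_eq by (rule summable_comparison_test'[where N = 0])
qed

lemma bergman_seqs_scale:
  assumes "c \<in> bergman_seqs"
  shows "(\<lambda>k. a * c k) \<in> bergman_seqs"
proof -
  have "summable (\<lambda>k. (cmod a)\<^sup>2 * ((cmod (c k))\<^sup>2 / (real k + 1)))"
    using assms unfolding bergman_seqs_def by (intro summable_mult) auto
  then show ?thesis
    by (simp add: bergman_seqs_def norm_mult power_mult_distrib)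
qed

text \<open>
With \<open>s = sqrt (k + 1)\<close>, the product \<open>\<bar>c k z ^ k\<bar> = (\<bar>c k\<bar> / s) * (s \<bar>z\<bar> ^ k)\<close> is at most the sum of the squares
of its factors; the first squares are summable by assumption and the second ones form the derivative of a
geometric series.
\<close>

lemma disc_series_sums:
  assumes c: "c \<in> bergman_seqs" and z: "z \<in> \<bbbD>"
  shows "(\<lambda>k. c k * z ^ k) sums disc_series c z"
proof -
  have z1: "norm ((cmod z)\<^sup>2) < 1"
    using z by (simp add: power_less_one_iff abs_square_less_1)
  have "summable (\<lambda>k. (cmod (c k))\<^sup>2 / (real k + 1) + of_nat (Suc k) * ((cmod z)\<^sup>2) ^ k)"
    using c geometric_deriv_sums[OF z1, THEN sums_summable] unfolding bergman_seqs_def by (intro summable_add) auto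
  moreover have "norm (c k * z ^ k) \<le> (cmod (c k))\<^sup>2 / (real k + 1) + of_nat (Suc k) * ((cmod z)\<^sup>2) ^ k" for k
  proof -
    define s where "s = sqrt (real k + 1)"
    have s: "s > 0" "s\<^sup>2 = real k + 1" by (simp_all add: s_def)
    have "norm (c k * z ^ k) = (cmod (c k) / s) * (s * cmod z ^ k)"
      using s by (simp add: norm_mult norm_power)
    also have "\<dots> \<le> (cmod (c k) / s)\<^sup>2 + (s * cmod z ^ k)\<^sup>2"
      using sum_squares_bound[of "cmod (c k) / s" "s * cmod z ^ k"]
        zero_le_power2[of "cmod (c k) / s"] zero_le_power2[of "s * cmod z ^ k"]
      by linarith
    also have "\<dots> = (cmod (c k))\<^sup>2 / (real k + 1) + of_nat (Suc k) * ((cmod z)\<^sup>2) ^ k"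
    proof -
      have "(cmod z ^ k)\<^sup>2 = ((cmod z)\<^sup>2) ^ k"
        by (simp only: power_mult[symmetric] mult.commute)
      then show ?thesis by (simp add: power_divide power_mult_distrib s)
    qed
    finally show ?thesis .
  qed
  ultimately have "summable (\<lambda>k. c k * z ^ k)"
    by (rule summable_comparison_test'[where N = 0])
  then show ?thesis using z by (simp add: disc_series_def summable_sums)
qed

lemma disc_series_unique:
  assumes "c \<in> bergman_seqs" "\<And>z. z \<in> \<bbbD> \<Longrightarrow> (\<lambda>k. c k * z ^ k) sums f z" "\<And>z. z \<notin> \<bbbD> \<Longrightarrow> f z = 0"
  shows "f = disc_series c"
proof
  fix z show "f z = disc_series c z"
  proof (cases "z \<in> \<bbbD>")
    case True
    show ?thesis
      by (rule sums_unique2[OF assms(2)[OF True] disc_series_sums[OF assms(1) True]])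
  qed (simp add: disc_series_def assms(3))
qed

lemma disc_series_add:
  assumes "c \<in> bergman_seqs" "d \<in> bergman_seqs"
  shows "disc_series (\<lambda>k. c k + d k) = (\<lambda>z. disc_series c z + disc_series d z)"
proof (rule disc_series_unique[symmetric, OF bergman_seqs_add[OF assms]])
  fix z assume "z \<in> \<bbbD>"
  from sums_add[OF disc_series_sums[OF assms(1) this] disc_series_sums[OF assms(2) this]]
  show "(\<lambda>k. (c k + d k) * z ^ k) sums (disc_series c z + disc_series d z)"
    by (simp only: distrib_right)
qed (simp add: disc_series_def)

lemma disc_series_scale:
  assumes "c \<in> bergman_seqs"
  shows "disc_series (\<lambda>k. a * c k) = (\<lambda>z. a * disc_series c z)"
proof (rule disc_series_unique[symmetric, OF bergman_seqs_scale[OF assms]])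
  fix z assume "z \<in> \<bbbD>"
  from sums_mult[OF disc_series_sums[OF assms this], of a]
  show "(\<lambda>k. a * c k * z ^ k) sums (a * disc_series c z)"
    by (simp only: mult.assoc)
qed (simp add: disc_series_def)

lemma disc_series_holomorphic:
  assumes "c \<in> bergman_seqs"
  shows "disc_series c holomorphic_on \<bbbD>"
  by (rule power_series_holomorphic) (use disc_series_sums[OF assms] in auto)

lemma nn_integral_disc_series:
  assumes "c \<in> bergman_seqs"
  shows "(\<integral>\<^sup>+z. ennreal ((cmod (disc_series c z))\<^sup>2) \<partial>lebesgue_on \<bbbD>)
       = ennreal (pi * seq_energy c)"
proof -
  have "(\<lambda>k. (cmod (c k))\<^sup>2 * (pi / (real k + 1))) sums (pi * seq_energy c)"
    unfolding seq_energy_def using sums_mult[OF summable_sums, of "\<lambda>k. (cmod (c k))\<^sup>2 / (real k + 1)" pi] assms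
    by (simp add: bergman_seqs_def mult_ac)
  then show ?thesis
    by (subst nn_integral_disc_power_series[where c = c])
       (use disc_series_sums[OF assms] disc_series_holomorphic[OF assms] in \<open>auto intro: suminf_ennreal_eq\<close>)
qed

lemma holomorphic_measurable_disc:
  assumes "f holomorphic_on \<bbbD>"
  shows "f \<in> borel_measurable (lebesgue_on \<bbbD>)"
  using assms by (intro continuous_imp_measurable_on_sets_lebesgue holomorphic_on_imp_continuous_on) auto

lemma disc_series_in_bergman:
  assumes "c \<in> bergman_seqs"
  shows "disc_series c \<in> bergman_space"
proof -
  note [measurable] = holomorphic_measurable_disc[OF disc_series_holomorphic[OF assms]]
  have "integrable (lebesgue_on \<bbbD>) (\<lambda>z. (cmod (disc_series c z))\<^sup>2)"
    by (rule integrableI_bounded) (use nn_integral_disc_series[OF assms] in auto)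
  then show ?thesis
    unfolding bergman_space_def L2_disc_def
    using disc_series_holomorphic[OF assms] by (auto simp: disc_series_def)
qed

text \<open>
The norm identity for power series, read from left to right: since the integral of \<open>\<bar>f\<bar>\<^sup>2\<close> is finite, so is the
weighted sum over the Taylor coefficients.
\<close>

lemma bergman_space_cases:
  assumes "f \<in> bergman_space"
  obtains c where "c \<in> bergman_seqs" "f = disc_series c"
proof -
  define c where "c k = (deriv ^^ k) f 0 / fact k" for k
  have hol: "f holomorphic_on \<bbbD>" and int: "integrable (lebesgue_on \<bbbD>) (\<lambda>z. (cmod (f z))\<^sup>2)"
    and off: "z \<notin> \<bbbD> \<Longrightarrow> f z = 0" for z
    using assms by (auto simp: bergman_space_def L2_disc_def)
  have sums: "(\<lambda>k. c k * z ^ k) sums f z" if "z \<in> \<bbbD>" for z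
    using holomorphic_power_series[OF hol that] by (simp add: c_def)
  have "(\<Sum>k. ennreal ((cmod (c k))\<^sup>2 * (pi / (real k + 1)))) < \<infinity>"
  proof -
    have "(\<integral>\<^sup>+z. ennreal ((cmod (f z))\<^sup>2) \<partial>lebesgue_on \<bbbD>) < \<infinity>"
      using int by (simp add: integrable_iff_bounded)
    then show ?thesis by (simp only: nn_integral_disc_power_series[OF sums hol])
  qed
  then have "summable (\<lambda>k. (cmod (c k))\<^sup>2 * (pi / (real k + 1)))"
    by (intro summable_suminf_not_top) auto
  then have "summable (\<lambda>k. inverse pi * ((cmod (c k))\<^sup>2 * (pi / (real k + 1))))"
    by (rule summable_mult)
  then have "c \<in> bergman_seqs"
    by (simp add: bergman_seqs_def field_simps)
  with disc_series_unique[OF this sums off] that show ?thesis by blast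
qed

lemma integral_norm_square_disc_series:
  assumes "c \<in> bergman_seqs"
  shows "(LINT z|lebesgue_on \<bbbD>. (cmod (disc_series c z))\<^sup>2) = pi * seq_energy c"
proof -
  have "0 \<le> seq_energy c"
    unfolding seq_energy_def using assms by (intro suminf_nonneg) (auto simp: bergman_seqs_def)
  then show ?thesis
    using holomorphic_measurable_disc[OF disc_series_holomorphic[OF assms]]
    by (subst integral_eq_nn_integral) (auto simp: nn_integral_disc_series[OF assms])
qed

lemma L2_disc_mult_integrable:
  assumes "f \<in> L2_disc" "g \<in> L2_disc"
  shows "integrable (lebesgue_on \<bbbD>) (\<lambda>z. f z * cnj (g z))"
proof (rule Bochner_Integration.integrable_bound)
  show "integrable (lebesgue_on \<bbbD>) (\<lambda>z. (cmod (f z))\<^sup>2 + (cmod (g z))\<^sup>2)"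
    using assms by (simp add: L2_disc_def)
  show "(\<lambda>z. f z * cnj (g z)) \<in> borel_measurable (lebesgue_on \<bbbD>)"
  proof -
    have [measurable]: "f \<in> borel_measurable (lebesgue_on \<bbbD>)" "g \<in> borel_measurable (lebesgue_on \<bbbD>)"
      using assms by (simp_all add: L2_disc_def)
    have [measurable]: "cnj \<in> borel_measurable borel"
      by (intro borel_measurable_continuous_onI continuous_intros)
    show ?thesis by measurable
  qed
  show "AE z in lebesgue_on \<bbbD>. norm (f z * cnj (g z)) \<le> norm ((cmod (f z))\<^sup>2 + (cmod (g z))\<^sup>2)"
  proof (rule AE_I2)
    fix z
    have "cmod (f z) * cmod (g z) \<le> (cmod (f z))\<^sup>2 + (cmod (g z))\<^sup>2"
      using sum_squares_bound[of "cmod (f z)" "cmod (g z)"]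
        zero_le_power2[of "cmod (f z)"] zero_le_power2[of "cmod (g z)"]
      by linarith
    then show "norm (f z * cnj (g z)) \<le> norm ((cmod (f z))\<^sup>2 + (cmod (g z))\<^sup>2)"
      by (simp add: norm_mult)
  qed
qed

text \<open>
Written with the multiples \<open>t * y\<close> for \<open>t\<close> in \<open>{1, -1, \<i>, -\<i>}\<close>, so that the identity applies in the same
form to functions and to their coefficients.
\<close>

lemma complex_polarization:
  "x * cnj y = (of_real ((cmod (x + y))\<^sup>2) - of_real ((cmod (x + (-1) * y))\<^sup>2)
      + \<i> * of_real ((cmod (x + \<i> * y))\<^sup>2) - \<i> * of_real ((cmod (x + (-\<i>) * y))\<^sup>2)) / 4"
  unfolding complex_norm_square by (simp add: algebra_simps)

text \<open>
The formula for norms determines the one for inner products by polarization, applied pointwise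
under the integral and termwise in the series.
\<close>

lemma L2_inner_disc_series:
  assumes c: "c \<in> bergman_seqs" and d: "d \<in> bergman_seqs"
  shows "(\<lambda>k. of_real pi * (c k * cnj (d k)) / of_nat (Suc k)) sums L2_inner (disc_series c) (disc_series d)"
proof -
  let ?M = "lebesgue_on \<bbbD>"
  \<comment> \<open>The four sequences that occur in the polarization identity.\<close>
  define e where "e t k = c k + t * d k" for t k
  have e: "e t \<in> bergman_seqs" for t
    unfolding e_def by (intro bergman_seqs_add bergman_seqs_scale c d)
  have E: "disc_series (e t) z = disc_series c z + t * disc_series d z" for t z
    unfolding e_def using c d bergman_seqs_scale[OF d, of t] by (simp add: disc_series_add disc_series_scale)
  define Q where "Q t = (LINT z|?M. (cmod (disc_series (e t) z))\<^sup>2)" for t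
  have intQ: "integrable ?M (\<lambda>z. complex_of_real ((cmod (disc_series (e t) z))\<^sup>2))" for t
    using disc_series_in_bergman[OF e[of t]] by (intro integrable_of_real) (simp add: bergman_space_def L2_disc_def)
  have Qint: "(LINT z|?M. complex_of_real ((cmod (disc_series (e t) z))\<^sup>2)) = of_real (Q t)" for t
    by (simp only: Q_def integral_complex_of_real)
  have Qsum: "(\<lambda>k. complex_of_real (pi * ((cmod (e t k))\<^sup>2 / (real k + 1)))) sums of_real (Q t)" for t
    unfolding Q_def integral_norm_square_disc_series[OF e] seq_energy_def using e[of t] unfolding bergman_seqs_def
    by (intro sums_of_real sums_mult summable_sums) auto
  have "L2_inner (disc_series c) (disc_series d) = (LINT z|?M. (of_real ((cmod (disc_series (e 1) z))\<^sup>2) - of_real ((cmod (disc_series (e (-1)) z))\<^sup>2)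
      + \<i> * of_real ((cmod (disc_series (e \<i>) z))\<^sup>2) - \<i> * of_real ((cmod (disc_series (e (-\<i>)) z))\<^sup>2)) / 4)"
    unfolding L2_inner_def E by (subst complex_polarization) simp
  also have "\<dots> = (of_real (Q 1) - of_real (Q (-1)) + \<i> * of_real (Q \<i>) - \<i> * of_real (Q (-\<i>))) / 4"
    using intQ by (simp add: Q_def del: of_real_power)
  finally have L: "L2_inner (disc_series c) (disc_series d) = \<dots>" .
  have "of_real pi * (c k * cnj (d k)) / of_nat (Suc k) =
      (of_real (pi * ((cmod (e 1 k))\<^sup>2 / (real k + 1))) - of_real (pi * ((cmod (e (-1) k))\<^sup>2 / (real k + 1)))
      + \<i> * of_real (pi * ((cmod (e \<i> k))\<^sup>2 / (real k + 1))) - \<i> * of_real (pi * ((cmod (e (-\<i>) k))\<^sup>2 / (real k + 1)))) / 4" for k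
  proof -
    define P where "P = complex_of_real pi / of_nat (Suc k)"
    have P: "complex_of_real (pi * (x / (real k + 1))) = P * of_real x" for x
      by (simp add: P_def add.commute)
    have lhs: "of_real pi * (c k * cnj (d k)) / of_nat (Suc k) = P * (c k * cnj (d k))"
      by (simp add: P_def)
    have pol: "c k * cnj (d k) = (of_real ((cmod (e 1 k))\<^sup>2) - of_real ((cmod (e (-1) k))\<^sup>2)
        + \<i> * of_real ((cmod (e \<i> k))\<^sup>2) - \<i> * of_real ((cmod (e (-\<i>) k))\<^sup>2)) / 4"
      unfolding e_def by (subst complex_polarization) (simp only: mult_1_left)
    show ?thesis
      unfolding lhs unfolding P pol by (simp add: algebra_simps del: of_real_power)
  qed
  then show ?thesis
    unfolding L by (simp only:) (intro sums_divide sums_diff sums_add sums_mult Qsum)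
qed

section \<open>Projections and adjoints through the inner product\<close>

lemma L2_inner_commute: "L2_inner g f = cnj (L2_inner f g)"
  unfolding L2_inner_def by (subst Bochner_Integration.integral_cnj[symmetric]) (simp add: mult.commute)

lemma L2_inner_diff_left:
  assumes "f \<in> L2_disc" "g \<in> L2_disc" "h \<in> L2_disc"
  shows "L2_inner (\<lambda>z. f z - g z) h = L2_inner f h - L2_inner g h"
  using L2_disc_mult_integrable[OF assms(1,3)] L2_disc_mult_integrable[OF assms(2,3)]
  unfolding L2_inner_def by (simp add: left_diff_distrib)

lemma L2_inner_self:
  assumes "c \<in> bergman_seqs"
  shows "L2_inner (disc_series c) (disc_series c) = of_real (pi * seq_energy c)"
proof -
  have "L2_inner (disc_series c) (disc_series c) = (LINT z|lebesgue_on \<bbbD>. complex_of_real ((cmod (disc_series c z))\<^sup>2))"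
    unfolding L2_inner_def complex_norm_square ..
  then show ?thesis
    by (simp only: integral_complex_of_real integral_norm_square_disc_series[OF assms])
qed

lemma bergman_space_L2: "f \<in> bergman_space \<Longrightarrow> f \<in> L2_disc"
  by (simp add: bergman_space_def)

lemma bergman_space_diff:
  assumes "f \<in> bergman_space" "g \<in> bergman_space"
  shows "(\<lambda>z. f z - g z) \<in> bergman_space"
proof -
  obtain c d where c: "c \<in> bergman_seqs" "f = disc_series c" and d: "d \<in> bergman_seqs" "g = disc_series d"
    using assms by (metis bergman_space_cases)
  have d': "(\<lambda>k. -1 * d k) \<in> bergman_seqs" by (rule bergman_seqs_scale[OF d(1)])
  have "disc_series (\<lambda>k. c k + -1 * d k) = (\<lambda>z. f z - g z)"
    unfolding disc_series_add[OF c(1) d'] disc_series_scale[OF d(1)] c d by simp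
  then show ?thesis
    using disc_series_in_bergman[OF bergman_seqs_add[OF c(1) d']] by simp
qed

lemma bergman_space_eqI:
  assumes f: "f \<in> bergman_space" and g: "g \<in> bergman_space"
    and eq: "\<And>h. h \<in> bergman_space \<Longrightarrow> L2_inner f h = L2_inner g h"
  shows "f = g"
proof -
  have diff: "(\<lambda>z. f z - g z) \<in> bergman_space" by (rule bergman_space_diff[OF f g])
  then obtain c where c: "c \<in> bergman_seqs" "(\<lambda>z. f z - g z) = disc_series c"
    by (rule bergman_space_cases)
  have "L2_inner (\<lambda>z. f z - g z) (\<lambda>z. f z - g z) = 0"
    using eq[OF diff] f g diff by (simp add: L2_inner_diff_left bergman_space_L2)
  then have "seq_energy c = 0"
    unfolding c(2) L2_inner_self[OF c(1)] by simp
  then have "\<forall>k. (cmod (c k))\<^sup>2 / (real k + 1) = 0"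
    unfolding seq_energy_def using c(1) by (subst (asm) suminf_eq_zero_iff) (auto simp: bergman_seqs_def)
  then have "c k = 0" for k by (auto dest: spec[of _ k])
  then have "disc_series c = (\<lambda>z. 0)" by (auto simp: disc_series_def)
  with c(2) show ?thesis by (metis (no_types) eq_iff_diff_eq_0 ext)
qed

text \<open>
Any candidate with the right inner products against the Bergman space is the projection, because
the inner product is definite there.
\<close>

lemma bergman_proj_eqI:
  assumes g: "g \<in> L2_disc" and p: "p \<in> bergman_space"
    and eq: "\<And>h. h \<in> bergman_space \<Longrightarrow> L2_inner g h = L2_inner p h"
  shows "bergman_proj g = p"
  unfolding bergman_proj_def
proof (rule the_equality)
  show "p \<in> bergman_space \<and> (\<forall>h\<in>bergman_space. L2_inner (\<lambda>z. g z - p z) h = 0)"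
    using assms by (simp add: L2_inner_diff_left bergman_space_L2)
next
  fix f assume f: "f \<in> bergman_space \<and> (\<forall>h\<in>bergman_space. L2_inner (\<lambda>z. g z - f z) h = 0)"
  show "f = p"
  proof (rule bergman_space_eqI)
    fix h assume h: "h \<in> bergman_space"
    then have "L2_inner g h - L2_inner f h = 0"
      using f g by (simp add: L2_inner_diff_left[symmetric] bergman_space_L2)
    then show "L2_inner f h = L2_inner p h" using eq[OF h] by simp
  qed (use f p in auto)
qed

lemma adjoint_on_bergman_eqI:
  assumes w: "w \<in> bergman_space"
    and eq: "\<And>u. u \<in> bergman_space \<Longrightarrow> L2_inner (T u) v = L2_inner u w"
  shows "adjoint_on bergman_space L2_inner T v = w"
  unfolding adjoint_on_def
proof (rule the_equality)
  show "w \<in> bergman_space \<and> (\<forall>u\<in>bergman_space. L2_inner (T u) v = L2_inner u w)"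
    using assms by simp
next
  fix w' assume w': "w' \<in> bergman_space \<and> (\<forall>u\<in>bergman_space. L2_inner (T u) v = L2_inner u w')"
  show "w' = w"
  proof (rule bergman_space_eqI)
    fix u assume "u \<in> bergman_space"
    then have "L2_inner u w' = L2_inner u w" using w' eq by metis
    then show "L2_inner w' u = L2_inner w u" by (metis L2_inner_commute)
  qed (use w w' in auto)
qed

section \<open>Energy inequalities for the coefficients\<close>

text \<open>
The coefficients of the projection of \<open>a * z ^ m * cnj z ^ n * f z\<close> when \<open>f\<close> has the coefficients \<open>c\<close>.
The guard keeps the natural subtraction \<open>k + n - m\<close> from being truncated.
\<close>

definition toeplitz_seq :: "complex \<Rightarrow> nat \<Rightarrow> nat \<Rightarrow> (nat \<Rightarrow> complex) \<Rightarrow> nat \<Rightarrow> complex" where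
  "toeplitz_seq a m n c k =
     (if m \<le> k + n then a * c (k + n - m) * of_real ((real k + 1) / (real k + real n + 1)) else 0)"

lemma suminf_tail_le:
  fixes g :: "nat \<Rightarrow> real"
  assumes "summable g" "\<And>k. 0 \<le> g k"
  shows "(\<Sum>k. g (k + n)) \<le> suminf g"
  using suminf_split_initial_segment[OF assms(1), of n] sum_nonneg[of "{..<n}" g] assms(2) by simp

text \<open>
Moving a sequence up by \<open>m\<close> places and then down by \<open>n\<close> places loses terms but adds only zeros.
\<close>

lemma shifted_summable:
  fixes g :: "nat \<Rightarrow> real" and m n :: nat
  assumes g: "summable g" "\<And>k. 0 \<le> g k"
  defines "h \<equiv> \<lambda>k. if m \<le> k + n then g (k + n - m) else 0"
  shows "summable h" "suminf h \<le> suminf g"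
proof -
  define s where "s k = (if m \<le> k then g (k - m) else 0)" for k
  have s: "s sums suminf g"
    using sums_zero_iff_shift[of m s "suminf g"] summable_sums[OF g(1)] by (simp add: s_def[abs_def])
  have h: "h = (\<lambda>k. s (k + n))" by (simp add: h_def s_def)
  show "summable h" unfolding h using s by (simp add: sums_summable summable_iff_shift)
  have "suminf h \<le> suminf s" unfolding h
    by (rule suminf_tail_le[OF sums_summable[OF s]]) (simp add: s_def g)
  then show "suminf h \<le> suminf g" using s by (simp add: sums_unique[symmetric])
qed

lemma toeplitz_seq_norm:
  "(cmod (toeplitz_seq a m n c k))\<^sup>2 / (real k + 1) =
     (if m \<le> k + n then (cmod a)\<^sup>2 * (cmod (c (k + n - m)))\<^sup>2 * ((real k + 1) / (real k + real n + 1)\<^sup>2) else 0)"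
proof (cases "m \<le> k + n")
  case True
  define r where "r = (real k + 1) / (real k + real n + 1)"
  have r: "0 \<le> r" by (simp add: r_def)
  have "cmod (toeplitz_seq a m n c k) = cmod a * cmod (c (k + n - m)) * r"
    using True r unfolding toeplitz_seq_def r_def[symmetric] by (simp add: norm_mult)
  then have "(cmod (toeplitz_seq a m n c k))\<^sup>2 / (real k + 1)
      = (cmod a)\<^sup>2 * (cmod (c (k + n - m)))\<^sup>2 * (r\<^sup>2 / (real k + 1))"
    by (simp add: power_mult_distrib)
  also have "r\<^sup>2 / (real k + 1) = (real k + 1) / (real k + real n + 1)\<^sup>2"
    by (simp add: r_def power_divide power2_eq_square)
  finally show ?thesis using True by simp
qed (simp add: toeplitz_seq_def)

text \<open>
For \<open>j = k + n - m\<close> the factor \<open>(k + 1) / (k + n + 1)\<^sup>2\<close> is at most the weight \<open>1 / (j + 1)\<close>, because both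
\<open>k + 1\<close> and \<open>j + 1\<close> are at most \<open>k + n + 1\<close>.
\<close>

lemma toeplitz_seq_bounded:
  assumes c: "c \<in> bergman_seqs"
  shows "toeplitz_seq a m n c \<in> bergman_seqs"
    and "seq_energy (toeplitz_seq a m n c) \<le> (cmod a)\<^sup>2 * seq_energy c"
proof -
  define g where "g k = (cmod a)\<^sup>2 * ((cmod (c k))\<^sup>2 / (real k + 1))" for k
  let ?h = "\<lambda>k. if m \<le> k + n then g (k + n - m) else 0"
  have g: "summable g" "\<And>k. 0 \<le> g k"
    using c summable_mult[of "\<lambda>k. (cmod (c k))\<^sup>2 / (real k + 1)" "(cmod a)\<^sup>2"]
    by (simp_all add: g_def[abs_def] bergman_seqs_def)
  have le: "(cmod (toeplitz_seq a m n c k))\<^sup>2 / (real k + 1) \<le> ?h k" for k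
  proof (cases "m \<le> k + n")
    case True
    define j where "j = k + n - m"
    have "(real k + 1) * (real j + 1) \<le> (real k + real n + 1) * (real k + real n + 1)"
      unfolding j_def by (intro mult_mono) (use True in auto)
    then have "(real k + 1) / (real k + real n + 1)\<^sup>2 \<le> 1 / (real j + 1)"
      by (simp add: divide_simps power2_eq_square)
    then have "(cmod a)\<^sup>2 * (cmod (c j))\<^sup>2 * ((real k + 1) / (real k + real n + 1)\<^sup>2)
        \<le> (cmod a)\<^sup>2 * (cmod (c j))\<^sup>2 * (1 / (real j + 1))"
      by (intro mult_left_mono) auto
    then show ?thesis using True by (simp add: toeplitz_seq_norm g_def j_def)
  qed (simp add: toeplitz_seq_norm)
  have h: "summable ?h" "suminf ?h \<le> suminf g"
    using shifted_summable[OF g] by blast+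
  have sm: "summable (\<lambda>k. (cmod (toeplitz_seq a m n c k))\<^sup>2 / (real k + 1))"
    by (rule summable_comparison_test'[OF h(1), where N = 0]) (use le in auto)
  then show "toeplitz_seq a m n c \<in> bergman_seqs" by (simp add: bergman_seqs_def)
  have "seq_energy (toeplitz_seq a m n c) \<le> suminf g"
    unfolding seq_energy_def using suminf_le[OF le sm h(1)] h(2) by linarith
  also have "suminf g = (cmod a)\<^sup>2 * seq_energy c"
    unfolding g_def seq_energy_def using c by (intro suminf_mult) (simp add: bergman_seqs_def)
  finally show "seq_energy (toeplitz_seq a m n c) \<le> (cmod a)\<^sup>2 * seq_energy c" .
qed

text \<open>
After clearing denominators and removing the common term \<open>(k + 1) y\<^sup>2\<close>, a factor \<open>d\<close> splits off and
\<open>(k + 1) (2 y + d) \<le> 2 y\<^sup>2\<close> remains; this follows from \<open>k + 1 \<le> y - d\<close>.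
\<close>

lemma weight_inequality:
  fixes k d y :: real
  assumes "0 \<le> k" "0 \<le> d" "k + 1 + d \<le> y"
  shows "(k + 1) / y\<^sup>2 \<le> (k + 2 * d + 1) / (y + d)\<^sup>2"
proof -
  have "(k + 1) * (2 * y + d) \<le> (y - d) * (2 * y + d)"
    using assms by (intro mult_right_mono) auto
  also have "\<dots> \<le> 2 * y\<^sup>2"
  proof -
    have "0 \<le> d * y + d * d" using assms by simp
    then show ?thesis by (simp add: algebra_simps power2_eq_square)
  qed
  finally have "d * ((k + 1) * (2 * y + d)) \<le> d * (2 * y\<^sup>2)"
    using assms by (intro mult_left_mono) auto
  then have "(k + 1) * (y + d)\<^sup>2 \<le> (k + 2 * d + 1) * y\<^sup>2"
    by (simp add: algebra_simps power2_eq_square)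
  moreover have "0 < y\<^sup>2" "0 < (y + d)\<^sup>2" using assms by auto
  ultimately show ?thesis by (simp add: divide_simps)
qed

text \<open>
Both sides are sums over the coefficients of \<open>c\<close>.  With \<open>d = m - n\<close>, the coefficient \<open>c (k + d)\<close> occurs in
the entry \<open>k\<close> on the left and in the entry \<open>k + 2 d\<close> on the right, where \<open>weight_inequality\<close> compares the
two factors.  The remaining entries on the right are nonnegative.
\<close>

lemma seq_energy_toeplitz_le:
  assumes nm: "n \<le> m" and c: "c \<in> bergman_seqs"
  shows "seq_energy (toeplitz_seq (cnj a) n m c) \<le> seq_energy (toeplitz_seq a m n c)"
proof -
  define d where "d = m - n"
  define A where "A k = (cmod (toeplitz_seq (cnj a) n m c k))\<^sup>2 / (real k + 1)" for k
  define B where "B k = (cmod (toeplitz_seq a m n c k))\<^sup>2 / (real k + 1)" for k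
  have A: "summable A" and B: "summable B"
    using toeplitz_seq_bounded(1)[OF c] by (simp_all add: A_def[abs_def] B_def[abs_def] bergman_seqs_def)
  have "A k \<le> B (k + 2 * d)" for k
  proof -
    have m: "real m = real n + real d" using nm by (simp add: d_def)
    have i: "k + m - n = k + d" "k + 2 * d + n - m = k + d" "m \<le> k + 2 * d + n"
      using nm by (auto simp: d_def)
    have "(real k + 1) / (real k + real m + 1)\<^sup>2 \<le> (real k + 2 * real d + 1) / ((real k + real m + 1) + real d)\<^sup>2"
      by (rule weight_inequality) (auto simp: m)
    then have "(cmod a)\<^sup>2 * (cmod (c (k + d)))\<^sup>2 * ((real k + 1) / (real k + real m + 1)\<^sup>2)
        \<le> (cmod a)\<^sup>2 * (cmod (c (k + d)))\<^sup>2 * ((real k + 2 * real d + 1) / ((real k + real m + 1) + real d)\<^sup>2)"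
      by (intro mult_left_mono) auto
    moreover have "(real k + real m + 1) + real d = real (k + 2 * d) + real n + 1" using m by simp
    ultimately show ?thesis
      using nm unfolding A_def B_def toeplitz_seq_norm by (simp add: i)
  qed
  then have "suminf A \<le> (\<Sum>k. B (k + 2 * d))"
    by (intro suminf_le A) (use B in \<open>simp_all add: summable_iff_shift\<close>)
  also have "\<dots> \<le> suminf B"
    by (rule suminf_tail_le[OF B]) (simp add: B_def)
  finally show ?thesis by (simp add: seq_energy_def A_def[abs_def] B_def[abs_def])
qed

section \<open>Action of the Toeplitz operator on coefficients\<close>

definition coeff_shift :: "nat \<Rightarrow> (nat \<Rightarrow> complex) \<Rightarrow> nat \<Rightarrow> complex" where
  "coeff_shift m c k = (if m \<le> k then c (k - m) else 0)"

lemma coeff_shift_in_bergman_seqs: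
  assumes "c \<in> bergman_seqs"
  shows "coeff_shift m c \<in> bergman_seqs"
proof -
  define g where "g k = (cmod (c k))\<^sup>2 / (real k + 1)" for k
  have "summable (\<lambda>k. if m \<le> k + 0 then g (k + 0 - m) else 0)"
    by (rule shifted_summable) (use assms in \<open>auto simp: g_def bergman_seqs_def\<close>)
  moreover have "norm ((cmod (coeff_shift m c k))\<^sup>2 / (real k + 1)) \<le> (if m \<le> k + 0 then g (k + 0 - m) else 0)" for k
    by (auto simp: coeff_shift_def g_def intro!: divide_left_mono)
  ultimately show ?thesis
    unfolding bergman_seqs_def mem_Collect_eq by (rule summable_comparison_test'[where N = 0])
qed

lemma disc_series_coeff_shift:
  assumes "c \<in> bergman_seqs"
  shows "disc_series (coeff_shift m c) = (\<lambda>z. z ^ m * disc_series c z)"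
proof (rule disc_series_unique[symmetric, OF coeff_shift_in_bergman_seqs[OF assms]])
  fix z assume z: "z \<in> \<bbbD>"
  have "(\<lambda>k. z ^ m * (c k * z ^ k)) sums (z ^ m * disc_series c z)"
    by (rule sums_mult[OF disc_series_sums[OF assms z]])
  moreover have "z ^ m * (c k * z ^ k) = coeff_shift m c (k + m) * z ^ (k + m)" for k
    by (simp add: coeff_shift_def power_add)
  ultimately have "(\<lambda>k. coeff_shift m c (k + m) * z ^ (k + m)) sums (z ^ m * disc_series c z)"
    by (simp only:)
  then show "(\<lambda>k. coeff_shift m c k * z ^ k) sums (z ^ m * disc_series c z)"
    by (subst (asm) sums_zero_iff_shift) (auto simp: coeff_shift_def)
qed (simp add: disc_series_def)

text \<open>
Moving \<open>cnj z ^ n\<close> to the second argument turns the left side into an inner product of the power series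
\<open>a z ^ m (\<Sum>k. c k z ^ k)\<close> and \<open>z ^ n (\<Sum>k. d k z ^ k)\<close>.  Its first \<open>n\<close> terms vanish, and the others are
those of the right side: the factor in \<open>toeplitz_seq\<close> is the quotient of the weights
\<open>1 / (k + n + 1)\<close> and \<open>1 / (k + 1)\<close>.
\<close>

lemma L2_inner_monomial_symbol:
  assumes c: "c \<in> bergman_seqs" and d: "d \<in> bergman_seqs"
  shows "L2_inner (\<lambda>z. a * z ^ m * cnj z ^ n * disc_series c z) (disc_series d)
       = L2_inner (disc_series (toeplitz_seq a m n c)) (disc_series d)"
proof -
  let ?c = "coeff_shift m (\<lambda>k. a * c k)" and ?d = "coeff_shift n d"
  have ac: "(\<lambda>k. a * c k) \<in> bergman_seqs" by (rule bergman_seqs_scale[OF c])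
  have "L2_inner (\<lambda>z. a * z ^ m * cnj z ^ n * disc_series c z) (disc_series d) = L2_inner (disc_series ?c) (disc_series ?d)"
    unfolding L2_inner_def disc_series_coeff_shift[OF ac] disc_series_coeff_shift[OF d] disc_series_scale[OF c]
    by (simp add: mult_ac)
  moreover have "(\<lambda>k. of_real pi * (?c k * cnj (?d k)) / of_nat (Suc k)) sums L2_inner (disc_series ?c) (disc_series ?d)"
    by (intro L2_inner_disc_series coeff_shift_in_bergman_seqs ac d)
  then have "(\<lambda>k. of_real pi * (?c (k + n) * cnj (?d (k + n))) / of_nat (Suc (k + n))) sums L2_inner (disc_series ?c) (disc_series ?d)"
    by (subst sums_zero_iff_shift) (auto simp: coeff_shift_def)
  moreover have "of_real pi * (?c (k + n) * cnj (?d (k + n))) / of_nat (Suc (k + n))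
      = of_real pi * (toeplitz_seq a m n c k * cnj (d k)) / of_nat (Suc k)" for k
  proof -
    define K N where "K = complex_of_nat (Suc k)" and "N = complex_of_nat (Suc (k + n))"
    have K: "K \<noteq> 0" unfolding K_def by (rule of_nat_neq_0)
    have r: "complex_of_real ((real k + 1) / (real k + real n + 1)) = K / N"
      by (simp add: K_def N_def add_ac)
    show ?thesis
      unfolding toeplitz_seq_def coeff_shift_def r K_def[symmetric] N_def[symmetric] using K by simp
  qed
  ultimately have "(\<lambda>k. of_real pi * (toeplitz_seq a m n c k * cnj (d k)) / of_nat (Suc k)) sums
      L2_inner (\<lambda>z. a * z ^ m * cnj z ^ n * disc_series c z) (disc_series d)"
    by (simp only:)
  then show ?thesis
    using L2_inner_disc_series[OF toeplitz_seq_bounded(1)[OF c] d] by (rule sums_unique2)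
qed

lemma monomial_symbol_L2:
  assumes f: "f \<in> bergman_space"
  shows "(\<lambda>z. a * z ^ m * cnj z ^ n * f z) \<in> L2_disc"
proof -
  have "continuous_on \<bbbD> f"
    using f by (simp add: bergman_space_def holomorphic_on_imp_continuous_on)
  then have meas: "(\<lambda>z. a * z ^ m * cnj z ^ n * f z) \<in> borel_measurable (lebesgue_on \<bbbD>)"
    by (intro continuous_imp_measurable_on_sets_lebesgue continuous_intros) auto
  have "integrable (lebesgue_on \<bbbD>) (\<lambda>z. (cmod (a * z ^ m * cnj z ^ n * f z))\<^sup>2)"
  proof (rule Bochner_Integration.integrable_bound)
    show "integrable (lebesgue_on \<bbbD>) (\<lambda>z. (cmod a)\<^sup>2 * (cmod (f z))\<^sup>2)"
      using bergman_space_L2[OF f] by (simp add: L2_disc_def)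
    show "(\<lambda>z. (cmod (a * z ^ m * cnj z ^ n * f z))\<^sup>2) \<in> borel_measurable (lebesgue_on \<bbbD>)"
      using meas by measurable
    show "AE z in lebesgue_on \<bbbD>. norm ((cmod (a * z ^ m * cnj z ^ n * f z))\<^sup>2) \<le> norm ((cmod a)\<^sup>2 * (cmod (f z))\<^sup>2)"
    proof (rule AE_I2)
      fix z assume "z \<in> space (lebesgue_on \<bbbD>)"
      then have z: "cmod z \<le> 1" by simp
      have "cmod (a * z ^ m * cnj z ^ n * f z) = cmod z ^ m * cmod z ^ n * (cmod a * cmod (f z))"
        by (simp add: norm_mult norm_power mult_ac)
      also have "\<dots> \<le> 1 * (cmod a * cmod (f z))"
        using z by (intro mult_right_mono mult_le_one power_le_one) auto
      finally have "(cmod (a * z ^ m * cnj z ^ n * f z))\<^sup>2 \<le> (cmod a * cmod (f z))\<^sup>2"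
        by (intro power_mono) auto
      then show "norm ((cmod (a * z ^ m * cnj z ^ n * f z))\<^sup>2) \<le> norm ((cmod a)\<^sup>2 * (cmod (f z))\<^sup>2)"
        by (simp add: power_mult_distrib)
    qed
  qed
  then show ?thesis using meas by (simp add: L2_disc_def)
qed

lemma toeplitz_disc_series:
  assumes \<phi>: "\<And>z. z \<in> \<bbbD> \<Longrightarrow> \<phi> z = a * z ^ m * cnj z ^ n" and c: "c \<in> bergman_seqs"
  shows "toeplitz \<phi> (disc_series c) = disc_series (toeplitz_seq a m n c)"
proof -
  have "(\<lambda>z. \<phi> z * disc_series c z) = (\<lambda>z. a * z ^ m * cnj z ^ n * disc_series c z)"
    using \<phi> by (auto simp: disc_series_def)
  moreover have "bergman_proj (\<lambda>z. a * z ^ m * cnj z ^ n * disc_series c z) = disc_series (toeplitz_seq a m n c)"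
  proof (rule bergman_proj_eqI)
    fix h assume "h \<in> bergman_space"
    then obtain d where "d \<in> bergman_seqs" "h = disc_series d" by (rule bergman_space_cases)
    then show "L2_inner (\<lambda>z. a * z ^ m * cnj z ^ n * disc_series c z) h = L2_inner (disc_series (toeplitz_seq a m n c)) h"
      using L2_inner_monomial_symbol[OF c] by simp
  qed (intro monomial_symbol_L2 disc_series_in_bergman toeplitz_seq_bounded c)+
  ultimately show ?thesis by (simp add: toeplitz_def)
qed

text \<open>
The formula \<open>L2_inner_monomial_symbol\<close> is used twice, for the symbol and, after conjugating the integral,
for the conjugate symbol, which has the exponents exchanged.
\<close>

lemma L2_inner_toeplitz_adjoint:
  assumes c: "c \<in> bergman_seqs" and d: "d \<in> bergman_seqs"
  shows "L2_inner (disc_series (toeplitz_seq a m n c)) (disc_series d)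
       = L2_inner (disc_series c) (disc_series (toeplitz_seq (cnj a) n m d))"
proof -
  have "L2_inner (disc_series (toeplitz_seq a m n c)) (disc_series d)
      = L2_inner (\<lambda>z. a * z ^ m * cnj z ^ n * disc_series c z) (disc_series d)"
    by (rule L2_inner_monomial_symbol[OF c d, symmetric])
  also have "\<dots> = cnj (L2_inner (\<lambda>z. cnj a * z ^ n * cnj z ^ m * disc_series d z) (disc_series c))"
    unfolding L2_inner_commute[symmetric] by (simp add: L2_inner_def mult_ac)
  also have "\<dots> = L2_inner (disc_series c) (disc_series (toeplitz_seq (cnj a) n m d))"
    unfolding L2_inner_monomial_symbol[OF d c] L2_inner_commute[symmetric] ..
  finally show ?thesis .
qed

section \<open>Hyponormality\<close>

theorem theorem2:
  fixes m n :: nat and a :: complex and \<phi> :: "complex \<Rightarrow> complex"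
  assumes "n \<le> m"
    and "\<And>z. z \<in> \<bbbD> \<Longrightarrow> \<phi> z = a * z ^ m * cnj z ^ n"
  shows "hyponormal_on bergman_space L2_inner (toeplitz \<phi>)"
proof -
  let ?T = "toeplitz \<phi>" and ?A = "adjoint_on bergman_space L2_inner (toeplitz \<phi>)"
  let ?S = "toeplitz_seq a m n" and ?S' = "toeplitz_seq (cnj a) n m"
  have T: "?T (disc_series c) = disc_series (?S c)" if "c \<in> bergman_seqs" for c
    using assms(2) that by (rule toeplitz_disc_series)
  have A: "?A (disc_series d) = disc_series (?S' d)" if d: "d \<in> bergman_seqs" for d
  proof (rule adjoint_on_bergman_eqI)
    fix u assume "u \<in> bergman_space"
    then obtain c where c: "c \<in> bergman_seqs" "u = disc_series c" by (rule bergman_space_cases)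
    show "L2_inner (?T u) (disc_series d) = L2_inner u (disc_series (?S' d))"
      unfolding c(2) T[OF c(1)] by (rule L2_inner_toeplitz_adjoint[OF c(1) d])
  qed (intro disc_series_in_bergman toeplitz_seq_bounded d)
  have "bounded_operator_on bergman_space L2_inner ?T"
    unfolding bounded_operator_on_def
  proof (intro conjI ballI allI exI)
    fix u assume "u \<in> bergman_space"
    then obtain c where c: "c \<in> bergman_seqs" "u = disc_series c" by (rule bergman_space_cases)
    show "?T u \<in> bergman_space"
      unfolding c(2) T[OF c(1)] by (intro disc_series_in_bergman toeplitz_seq_bounded c)
    show "?T (\<lambda>x. b * u x) = (\<lambda>x. b * ?T u x)" for b
    proof -
      have "?S (\<lambda>k. b * c k) = (\<lambda>k. b * ?S c k)"
        by (auto simp: toeplitz_seq_def)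
      then show ?thesis
        using T[OF bergman_seqs_scale[OF c(1), of b]] T[OF c(1)]
        by (simp add: c disc_series_scale toeplitz_seq_bounded)
    qed
    have "sqrt (pi * seq_energy (?S c)) \<le> sqrt ((cmod a)\<^sup>2 * (pi * seq_energy c))"
      using toeplitz_seq_bounded(2)[OF c(1), of a m n] by (simp add: mult.left_commute)
    then show "sqrt (Re (L2_inner (?T u) (?T u))) \<le> cmod a * sqrt (Re (L2_inner u u))"
      unfolding c(2) T[OF c(1)] L2_inner_self[OF c(1)] L2_inner_self[OF toeplitz_seq_bounded(1)[OF c(1)]] Re_complex_of_real
      by (simp add: real_sqrt_mult)
    fix v assume "v \<in> bergman_space"
    then obtain d where d: "d \<in> bergman_seqs" "v = disc_series d" by (rule bergman_space_cases)
    have "?S (\<lambda>k. c k + d k) = (\<lambda>k. ?S c k + ?S d k)"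
      by (auto simp: toeplitz_seq_def algebra_simps)
    then show "?T (\<lambda>x. u x + v x) = (\<lambda>x. ?T u x + ?T v x)"
      using T[OF bergman_seqs_add[OF c(1) d(1)]] T[OF c(1)] T[OF d(1)]
      by (simp add: c d disc_series_add toeplitz_seq_bounded)
  qed
  moreover have "L2_inner (\<lambda>x. ?A (?T u) x - ?T (?A u) x) u \<in> \<real>\<^sub>\<ge>\<^sub>0" if "u \<in> bergman_space" for u
  proof -
    from that obtain c where c: "c \<in> bergman_seqs" "u = disc_series c" by (rule bergman_space_cases)
    have S: "?S b \<in> bergman_seqs" "?S' b \<in> bergman_seqs" if "b \<in> bergman_seqs" for b
      using that by (rule toeplitz_seq_bounded)+
    \<comment> \<open>The adjoint of the weighted shift for the conjugate symbol is the original one.\<close>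
    have 1: "L2_inner (?A (?T u)) u = of_real (pi * seq_energy (?S c))"
      unfolding c(2) T[OF c(1)] A[OF S(1)[OF c(1)]]
      using L2_inner_toeplitz_adjoint[OF S(1)[OF c(1)] c(1), of "cnj a" n m] L2_inner_self[OF S(1)[OF c(1)]]
      by simp
    have 2: "L2_inner (?T (?A u)) u = of_real (pi * seq_energy (?S' c))"
      unfolding c(2) A[OF c(1)] T[OF S(2)[OF c(1)]]
      using L2_inner_toeplitz_adjoint[OF S(2)[OF c(1)] c(1), of a m n] L2_inner_self[OF S(2)[OF c(1)]]
      by simp
    have "?A (?T u) \<in> L2_disc" "?T (?A u) \<in> L2_disc" "u \<in> L2_disc"
      unfolding c(2) using c(1) by (simp_all add: T A S disc_series_in_bergman bergman_space_L2)
    then have "L2_inner (\<lambda>x. ?A (?T u) x - ?T (?A u) x) u = of_real (pi * (seq_energy (?S c) - seq_energy (?S' c)))"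
      by (simp only: L2_inner_diff_left 1 2) (simp add: algebra_simps)
    moreover have "0 \<le> pi * (seq_energy (?S c) - seq_energy (?S' c))"
      using seq_energy_toeplitz_le[OF assms(1) c(1), of a] by simp
    ultimately show ?thesis
      by (simp only: nonneg_Reals_of_real_iff)
  qed
  ultimately show ?thesis
    unfolding hyponormal_on_def by blast
qed

end
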